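(* Let $(\Theta,\mathcal{T})$ be a measurable space, $\pi\in\mathcal{P}(\Theta)$, $\eta>0$, let $(\ell_t)_{t\in\mathbb{N}}$ be a sequence of $\mathcal{T}$-measurable functions $\ell_t:\Theta\to\mathbb{R}_+$, and let $\phi:\mathbb{R}_+\to\mathbb{R}\cup\{+\infty\}$ be strictly convex with $\phi(1)=0$ and $\inf_{x\ge 0}\phi(x)>-\infty$. Assume that there are a norm $N$ on $\mathcal{M}(\Theta)$ and real numbers $\alpha,L>0$ such that: (i) for any $\rho\in\mathcal{M}(\Theta)$, $N(\rho)\ge N_{\rm TV}(\rho)$; (ii) for any $t\in\mathbb{N}$ and any $(\rho,\rho')\in\mathcal{P}_{D_\phi,\pi}(\Theta)^2$, $$\left|\mathbb{E}_{\theta\sim\rho}[\ell_t(\theta)]-\mathbb{E}_{\theta\sim\rho'}[\ell_t(\theta)]\right|\le L\,N(\rho-\rho');$$ (iii) for any $\gamma\in[0,1]$ and any $(\rho,\rho')\in\mathcal{P}_{D_\phi,\pi}(\Theta)^2$, $$D_\phi(\gamma\rho+(1-\gamma)\rho'\|\pi)\le \gamma D_\phi(\rho\|\pi)+(1-\gamma)D_\phi(\rho'\|\pi)-\frac{\alpha}{2}\gamma(1-\gamma)N(\rho-\rho')^2.$$ Assume moreover that each $\ell_t$ is $\pi$-integrable. Then for each $t\ge 1$ the minimizer $$\rho^t=\operatorname*{argmin}_{\rho\in\mathcal{P}(\Theta)}\left\{\sum_{s=1}^{t-1}\mathbb{E}_{\theta\sim\rho}[\ell_s(\theta)]+\frac{D_\phi(\rho\|\pi)}{\eta}\right\}$$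 exists and is unique, and for every $T\ge 1$, $$\sum_{t=1}^T\mathbb{E}_{\theta\sim\rho^t}[\ell_t(\theta)]\le\inf_{\rho\in\mathcal{P}(\Theta)}\left\{\sum_{t=1}^T\mathbb{E}_{\theta\sim\rho}[\ell_t(\theta)]+\frac{\eta L^2T}{\alpha}+\frac{D_\phi(\rho\|\pi)}{\eta}\right\}.$$
   Context: $\mathcal{P}(\Theta)$ is the set of all probability distributions on $(\Theta,\mathcal{T})$ and $\mathcal{M}(\Theta)$ is the set of all finite signed measures on $(\Theta,\mathcal{T})$. A norm on $\mathcal{M}(\Theta)$ is here a function $N:\mathcal{M}(\Theta)\to[0,\infty]$ (the value $+\infty$ is allowed) with $N(\nu)=0\Leftrightarrow\nu=0$, $N(\nu+\mu)\le N(\nu)+N(\mu)$, and $N(\lambda\nu)=|\lambda|N(\nu)$ for $\lambda\in\mathbb{R}$. The total variation norm is $N_{\rm TV}(\nu)=\sup_{A\in\mathcal{T}}|\nu(A)|$. The $\phi$-divergence is $D_\phi(\rho\|\pi)=\mathbb{E}_{\theta\sim\pi}\left[\phi\left(\frac{d\rho}{d\pi}(\theta)\right)\right]$ if $\rho\ll\pi$, and $+\infty$ otherwise. $\mathcal{P}_{D_\phi,\pi}(\Theta)=\{\rho\in\mathcal{P}(\Theta):D_\phi(\rho\|\pi)<+\infty\}$.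
   Formalization: φ is additionally assumed lower semicontinuous on [0,∞); without this the minimizer may fail to exist (e.g. two points, π uniform, φ(x)=(x−1)² for x>0 but φ(0)=5, losses 0 and K>4). *)

theory Defs
  imports "HOL-Probability.Probability"
begin

abbreviation prob_measures :: "'a measure \<Rightarrow> 'a measure set" where
  "prob_measures M \<equiv> space (prob_algebra M)"

(* A finite signed measure on the measurable space underlying M is a countably additive
   real-valued set function on sets M. It is set to 0 off sets M, as measure is, so that equality
   of signed measures is equality of functions and measure \<rho> is the signed measure of a
   probability \<rho>. Countable additivity on the constant empty sequence gives \<nu> {} = 0. *)
definition signed_measures :: "'a measure \<Rightarrow> ('a set \<Rightarrow> real) set" where
  "signed_measures M =
     {\<nu>. (\<forall>A. A \<notin> sets M \<longrightarrow> \<nu> A = 0) \<and>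
         (\<forall>A :: nat \<Rightarrow> 'a set. range A \<subseteq> sets M \<longrightarrow> disjoint_family A \<longrightarrow>
            (\<lambda>i. \<nu> (A i)) sums \<nu> (\<Union>i. A i))}"

definition measure_norm :: "'a measure \<Rightarrow> (('a set \<Rightarrow> real) \<Rightarrow> ennreal) \<Rightarrow> bool" where
  "measure_norm M N \<longleftrightarrow>
     (\<forall>\<nu>\<in>signed_measures M. N \<nu> = 0 \<longleftrightarrow> \<nu> = (\<lambda>A. 0)) \<and>
     (\<forall>\<nu>\<in>signed_measures M. \<forall>\<mu>\<in>signed_measures M. N (\<lambda>A. \<nu> A + \<mu> A) \<le> N \<nu> + N \<mu>) \<and>
     (\<forall>\<nu>\<in>signed_measures M. \<forall>c. N (\<lambda>A. c * \<nu> A) = ennreal \<bar>c\<bar> * N \<nu>)"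

definition tv_norm :: "'a measure \<Rightarrow> ('a set \<Rightarrow> real) \<Rightarrow> ennreal" where
  "tv_norm M \<nu> = (SUP A\<in>sets M. ennreal \<bar>\<nu> A\<bar>)"

definition diff_measures :: "'a measure \<Rightarrow> 'a measure \<Rightarrow> 'a set \<Rightarrow> real" where
  "diff_measures \<rho> \<rho>' = (\<lambda>A. measure \<rho> A - measure \<rho>' A)"

definition mixture :: "real \<Rightarrow> 'a measure \<Rightarrow> 'a measure \<Rightarrow> 'a measure" where
  "mixture \<gamma> \<rho> \<rho>' = measure_of (space \<rho>) (sets \<rho>)
     (\<lambda>A. ennreal \<gamma> * emeasure \<rho> A + ennreal (1 - \<gamma>) * emeasure \<rho>' A)"

lemma emeasure_mixture:
  assumes [simp]: "sets \<rho>' = sets \<rho>"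
  shows "emeasure (mixture \<gamma> \<rho> \<rho>') A =
    ennreal \<gamma> * emeasure \<rho> A + ennreal (1 - \<gamma>) * emeasure \<rho>' A"
proof (cases "A \<in> sets \<rho>")
  case True
  let ?\<mu> = "\<lambda>A. ennreal \<gamma> * emeasure \<rho> A + ennreal (1 - \<gamma>) * emeasure \<rho>' A"
  have "countably_additive (sets \<rho>) ?\<mu>"
    unfolding countably_additive_def
    by (auto simp: suminf_add[symmetric] suminf_emeasure)
  then show ?thesis
    using True unfolding mixture_def
    by (subst emeasure_measure_of_sigma) (auto simp: positive_def sets.sigma_algebra_axioms)
next
  case False
  then show ?thesis
    by (simp add: mixture_def emeasure_notin_sets)
qed

(* Expectation of an extended-real function whose negative part has finite integral (here the
   integrands are bounded below): E[f^+] - E[f^-]. Note that e2ennreal truncates at 0. *)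
definition ereal_expectation :: "'a measure \<Rightarrow> ('a \<Rightarrow> ereal) \<Rightarrow> ereal" where
  "ereal_expectation M f =
     enn2ereal (\<integral>\<^sup>+ x. e2ennreal (f x) \<partial>M) - enn2ereal (\<integral>\<^sup>+ x. e2ennreal (- f x) \<partial>M)"

definition phi_divergence :: "(real \<Rightarrow> ereal) \<Rightarrow> 'a measure \<Rightarrow> 'a measure \<Rightarrow> ereal" where
  "phi_divergence \<phi> \<rho> \<pi> =
     (if absolutely_continuous \<pi> \<rho>
      then ereal_expectation \<pi> (\<lambda>\<theta>. \<phi> (enn2real (RN_deriv \<pi> \<rho> \<theta>)))
      else \<infinity>)"

definition finite_div_measures :: "(real \<Rightarrow> ereal) \<Rightarrow> 'a measure \<Rightarrow> 'a measure set" where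
  "finite_div_measures \<phi> \<pi> = {\<rho> \<in> prob_measures \<pi>. phi_divergence \<phi> \<rho> \<pi> < \<infinity>}"

(* Strict convexity on [0, \<infinity>) of a function with values in (-\<infinity>, \<infinity>]: the strict inequality is
   required between points of the effective domain; elsewhere the right-hand side is \<infinity>. *)
definition strictly_convex_nonneg :: "(real \<Rightarrow> ereal) \<Rightarrow> bool" where
  "strictly_convex_nonneg \<phi> \<longleftrightarrow>
     (\<forall>x\<ge>0. \<phi> x \<noteq> -\<infinity>) \<and>
     (\<forall>x\<ge>0. \<forall>y\<ge>0. \<forall>u. x \<noteq> y \<longrightarrow> \<phi> x < \<infinity> \<longrightarrow> \<phi> y < \<infinity> \<longrightarrow> 0 < u \<longrightarrow> u < 1 \<longrightarrow>
        \<phi> (u * x + (1 - u) * y) < ereal u * \<phi> x + ereal (1 - u) * \<phi> y)"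

(* For a (-\<infinity>, \<infinity>]-valued convex function this only excludes upward jumps at the end
   points of the effective domain; with such a jump (e.g. (x - 1)^2 with the value at 0 raised to 5)
   the penalised loss need not attain its infimum. *)
definition lsc_nonneg :: "(real \<Rightarrow> ereal) \<Rightarrow> bool" where
  "lsc_nonneg \<phi> \<longleftrightarrow> (\<forall>x\<ge>0. \<phi> x \<le> Liminf (at x within {0..}) \<phi>)"

definition exp_loss :: "(nat \<Rightarrow> 'a \<Rightarrow> real) \<Rightarrow> nat \<Rightarrow> 'a measure \<Rightarrow> ereal" where
  "exp_loss loss t \<rho> = ereal_expectation \<rho> (\<lambda>\<theta>. ereal (loss t \<theta>))"

definition ftrl_objective ::
  "(nat \<Rightarrow> 'a \<Rightarrow> real) \<Rightarrow> (real \<Rightarrow> ereal) \<Rightarrow> 'a measure \<Rightarrow> real \<Rightarrow> nat \<Rightarrow> 'a measure \<Rightarrow> ereal" where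
  "ftrl_objective loss \<phi> \<pi> \<eta> t \<rho> =
     (\<Sum>s = 1..<t. exp_loss loss s \<rho>) + phi_divergence \<phi> \<rho> \<pi> / ereal \<eta>"

end

(* The divergence D is strongly convex with respect to a norm dominating total variation, so each
   penalised loss F_t is strongly convex as well. Comparing F_t at two nearly minimal points and at
   their midpoint shows that a minimising sequence is Cauchy in total variation, fast enough (for
   values within 4^-k of the infimum) for its densities to converge almost everywhere; Fatou's
   lemma and the lower semicontinuity of \<phi> make the limit a minimiser.

   For the regret, the midpoint inequality gives
     F_t(\<rho>^(t+1)) \<ge> F_t(\<rho>^t) + \<alpha> / (4 \<eta>) N(\<rho>^t - \<rho>^(t+1))^2,
   and the Lipschitz bound replaces the loss of \<rho>^(t+1) by that of \<rho>^t at the price L N, so that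
   F_(t+1)(\<rho>^(t+1)) - F_t(\<rho>^t) is at least the loss of \<rho>^t minus \<eta> L^2 / \<alpha>. These
   increments telescope, and F_1 \<ge> 0 by Jensen's inequality. *)
theory Submission
  imports Defs
begin

section \<open>Lower semicontinuity on the half line\<close>

lemma lsc_nonneg_liminf:
  assumes "lsc_nonneg \<phi>" "X \<longlonglongrightarrow> x" "\<And>n. 0 \<le> X n"
  shows "\<phi> x \<le> liminf (\<lambda>n. \<phi> (X n))"
  unfolding le_Liminf_iff
proof (intro allI impI)
  fix y assume y: "y < \<phi> x"
  have x: "0 \<le> x"
    using assms(2,3) by (meson LIMSEQ_le_const)
  then have "\<forall>\<^sub>F z in at x within {0..}. y < \<phi> z"
    using assms(1) y unfolding lsc_nonneg_def le_Liminf_iff by blast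
  \<comment> \<open>The filter \<open>at x within {0..}\<close> leaves out x itself. There the
    inequality is the choice of y, so the full neighbourhood filter may be used and the sequence may
    take the value x.\<close>
  then have "\<forall>\<^sub>F z in nhds x. z \<in> {0..} \<longrightarrow> y < \<phi> z"
    unfolding eventually_at_filter by eventually_elim (use y in auto)
  then have "\<forall>\<^sub>F n in sequentially. X n \<in> {0..} \<longrightarrow> y < \<phi> (X n)"
    using assms(2) by (rule eventually_compose_filterlim)
  then show "\<forall>\<^sub>F n in sequentially. y < \<phi> (X n)"
    using assms(3) by simp
qed

lemma lsc_nonneg_closed_sublevel:
  assumes "lsc_nonneg \<phi>"
  shows "closed {x. 0 \<le> x \<and> \<phi> x \<le> c}"
  unfolding closed_sequential_limits
proof (intro allI impI, elim conjE)
  fix X x assume X: "\<forall>n. X n \<in> {x. 0 \<le> x \<and> \<phi> x \<le> c}" and lim: "X \<longlonglongrightarrow> x"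
  have "\<phi> x \<le> liminf (\<lambda>n. \<phi> (X n))"
    using X by (intro lsc_nonneg_liminf[OF assms lim]) auto
  also have "\<dots> \<le> liminf (\<lambda>n. c)"
    using X by (intro Liminf_mono) auto
  finally have "\<phi> x \<le> c"
    by (simp add: Liminf_const)
  moreover have "0 \<le> x"
    using X lim by (metis (no_types, lifting) LIMSEQ_le_const mem_Collect_eq)
  ultimately show "x \<in> {x. 0 \<le> x \<and> \<phi> x \<le> c}"
    by simp
qed

text \<open>Sublevel sets of \<phi> within [0, \<infinity>) are closed, hence Borel; as
  \<open>f\<close> never leaves [0, \<infinity>), their preimages are exactly the sublevel sets of
  the composition.\<close>

lemma lsc_nonneg_measurable:
  assumes \<phi>: "lsc_nonneg \<phi>" and [measurable]: "f \<in> borel_measurable M"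
    and f: "\<And>x. 0 \<le> f x"
  shows "(\<lambda>x. \<phi> (f x)) \<in> borel_measurable M"
proof (rule borel_measurableI_le)
  fix c
  have [measurable]: "{x. 0 \<le> x \<and> \<phi> x \<le> c} \<in> sets borel"
    using lsc_nonneg_closed_sublevel[OF \<phi>] by (rule borel_closed)
  have "{x \<in> space M. f x \<in> {x. 0 \<le> x \<and> \<phi> x \<le> c}} \<in> sets M"
    by measurable
  then show "{x \<in> space M. \<phi> (f x) \<le> c} \<in> sets M"
    using f by simp
qed

section \<open>Supporting lines at 1\<close>

text \<open>If \<phi> is finite somewhere on each side of 1, then 1 is interior to the effective
  domain, and a real convex function has a supporting line at an interior point. At an end point of
  the domain the slope can be infinite, as for (x - 1)^2 - sqrt (x - 1) on [1, \<infinity>); the two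
  one-sided cases account for this.\<close>

lemma strictly_convex_nonneg_tangent:
  assumes conv: "strictly_convex_nonneg \<phi>" and one: "\<phi> 1 = 0"
  shows "(\<exists>c. \<forall>x\<ge>0. ereal (c * (x - 1)) \<le> \<phi> x) \<or>
    (\<forall>x>1. \<phi> x = \<infinity>) \<or> (\<forall>x. 0 \<le> x \<and> x < 1 \<longrightarrow> \<phi> x = \<infinity>)"
proof (rule ccontr)
  assume neg: "\<not> ?thesis"
  \<comment> \<open>\<open>I\<close> is the effective domain and \<open>f\<close> agrees with \<phi>
    on it, so that the theory of real convex functions applies.\<close>
  define I where "I = {x. 0 \<le> x \<and> \<phi> x < \<infinity>}"
  define f where "f x = real_of_ereal (\<phi> x)" for x
  have fin: "\<phi> x = ereal (f x)" if "x \<in> I" for x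
    using that conv unfolding I_def f_def strictly_convex_nonneg_def by (cases "\<phi> x") auto
  have step: "u * x + (1 - u) * y \<in> I \<and> f (u * x + (1 - u) * y) \<le> u * f x + (1 - u) * f y"
    if "x \<in> I" "y \<in> I" "0 < u" "u < 1" for x y u
  proof (cases "x = y")
    case True
    then show ?thesis using that by (simp add: algebra_simps)
  next
    case False
    have "\<phi> (u * x + (1 - u) * y) < ereal u * \<phi> x + ereal (1 - u) * \<phi> y"
      using conv that False unfolding strictly_convex_nonneg_def I_def by auto
    \<comment> \<open>The right-hand side is finite, which puts the convex combination back into the
      domain.\<close>
    then have lt: "\<phi> (u * x + (1 - u) * y) < ereal (u * f x + (1 - u) * f y)"
      using that by (simp add: fin)
    then have "u * x + (1 - u) * y \<in> I"
      using that unfolding I_def by auto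
    with lt show ?thesis
      by (simp add: fin)
  qed
  have I: "is_interval I"
    unfolding is_interval_convex_1 convex_alt
  proof (intro ballI allI impI, elim conjE)
    fix x y u :: real assume "x \<in> I" "y \<in> I" "0 \<le> u" "u \<le> 1"
    then show "(1 - u) *\<^sub>R x + u *\<^sub>R y \<in> I"
      using step[of y x u] by (cases "u = 0 \<or> u = 1") (auto simp: algebra_simps)
  qed
  have cf: "convex_on I f"
    proof (rule convex_onI)
    fix t x y :: real assume "0 < t" "t < 1" "x \<in> I" "y \<in> I"
    then show "f ((1 - t) *\<^sub>R x + t *\<^sub>R y) \<le> (1 - t) * f x + t * f y"
      using step[of x y "1 - t"] by simp
  qed (use I in \<open>simp add: is_interval_convex_1\<close>)
  obtain a b where ab: "a \<in> I" "a < 1" "b \<in> I" "1 < b"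
  proof -
    obtain a b where "0 \<le> a" "a < 1" "\<phi> a \<noteq> \<infinity>" "1 < b" "\<phi> b \<noteq> \<infinity>"
      using neg by blast
    then show thesis
      using that[of a b] by (simp add: I_def less_top[symmetric] top_ereal_def)
  qed
  have "{a<..<b} \<subseteq> I"
    using I ab unfolding is_interval_1 by (meson greaterThanLessThan_iff less_imp_le subsetI)
  then have int: "1 \<in> interior I"
    using ab by (intro interiorI[of "{a<..<b}"]) auto
  have "\<exists>c. \<forall>x\<ge>0. ereal (c * (x - 1)) \<le> \<phi> x"
  proof (intro exI allI impI)
    fix x :: real assume "0 \<le> x"
    \<comment> \<open>The right derivative of \<open>f\<close> at 1: the infimum of the slopes of
      chords from 1 to points of \<open>I\<close> beyond it.\<close>
    let ?c = "Inf ((\<lambda>t. (f 1 - f t) / (1 - t)) ` ({1<..} \<inter> I))"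
    show "ereal (?c * (x - 1)) \<le> \<phi> x"
    proof (cases "x \<in> I")
      case True
      then show ?thesis
        using convex_le_Inf_differential[OF cf int True] one by (simp add: fin) (simp add: f_def)
    qed (use \<open>0 \<le> x\<close> in \<open>auto simp: I_def\<close>)
  qed
  with neg show False by blast
qed

(* When \<phi> has no tangent at 1, its domain lies on one side of 1, and a function of mean 1 with
   values in the domain is almost everywhere 1. *)
lemma (in prob_space) strictly_convex_nonneg_tangent_AE:
  assumes conv: "strictly_convex_nonneg \<phi>" and one: "\<phi> 1 = 0"
    and int: "integrable M f" "expectation f = 1" and nonneg: "\<And>x. 0 \<le> f x"
    and fin: "AE x in M. \<phi> (f x) \<noteq> \<infinity>"
  shows "\<exists>c. AE x in M. ereal (c * (f x - 1)) \<le> \<phi> (f x)"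
proof -
  have eq_one: ?thesis if "AE x in M. f x = 1"
    using that by (intro exI[of _ 0]) (auto simp: one)
  \<comment> \<open>A function bounded by its mean on one side is almost everywhere equal to it: the
    difference is nonnegative with integral 0.\<close>
  have "AE x in M. 1 - f x = 0" if "AE x in M. f x \<le> 1"
    using that int by (subst integral_nonneg_eq_0_iff_AE[symmetric]) (auto simp: prob_space)
  moreover have "AE x in M. f x - 1 = 0" if "AE x in M. 1 \<le> f x"
    using that int by (subst integral_nonneg_eq_0_iff_AE[symmetric]) (auto simp: prob_space)
  ultimately have le: "AE x in M. f x = 1" if "(AE x in M. f x \<le> 1) \<or> (AE x in M. 1 \<le> f x)"
    using that by (elim disjE) auto
  from strictly_convex_nonneg_tangent[OF conv one] show ?thesis
  proof (elim disjE exE)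
    fix c assume "\<forall>x\<ge>0. ereal (c * (x - 1)) \<le> \<phi> x"
    then show ?thesis using nonneg by (intro exI[of _ c]) auto
  next
    assume *: "\<forall>x>1. \<phi> x = \<infinity>"
    have "AE x in M. f x \<le> 1"
      using fin by eventually_elim (use * in force)
    then show ?thesis using le eq_one by blast
  next
    assume *: "\<forall>x. 0 \<le> x \<and> x < 1 \<longrightarrow> \<phi> x = \<infinity>"
    have "AE x in M. 1 \<le> f x"
      using fin by eventually_elim (use * nonneg in force)
    then show ?thesis using le eq_one by blast
  qed
qed

section \<open>Extended-real expectations and integrals over mixtures\<close>

lemma ereal_expectation_nonneg:
  assumes "\<And>x. x \<in> space M \<Longrightarrow> 0 \<le> f x"
  shows "ereal_expectation M f = enn2ereal (\<integral>\<^sup>+ x. e2ennreal (f x) \<partial>M)"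
proof -
  have "(\<integral>\<^sup>+ x. e2ennreal (- f x) \<partial>M) = (\<integral>\<^sup>+ x. 0 \<partial>M)"
    using assms by (intro nn_integral_cong) (auto simp: e2ennreal_neg)
  then show ?thesis
    by (simp add: ereal_expectation_def zero_ennreal.rep_eq)
qed

text \<open>Since f \<ge> -B, pointwise (f + B) + f^- = f^+ + B. Integrate, then cancel the integral
  of f^-, which is at most B and hence finite.\<close>

lemma (in prob_space) ereal_expectation_shift:
  assumes [measurable]: "f \<in> borel_measurable M" and f: "\<And>x. - ereal B \<le> f x" and B: "0 \<le> B"
  shows "ereal_expectation M f = enn2ereal (\<integral>\<^sup>+ x. e2ennreal (f x + ereal B) \<partial>M) - ereal B"
proof -
  have "e2ennreal (f x + ereal B) + e2ennreal (- f x) = e2ennreal (f x) + ennreal B" for x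
  proof (cases "f x")
    case (real r)
    then show ?thesis
      using f[of x] B by (cases "0 \<le> r") (auto simp: ennreal_neg ennreal_plus[symmetric] simp del: ennreal_plus)
  qed (use f[of x] in auto)
  then have "(\<integral>\<^sup>+ x. e2ennreal (f x + ereal B) + e2ennreal (- f x) \<partial>M) =
      (\<integral>\<^sup>+ x. e2ennreal (f x) + ennreal B \<partial>M)"
    by simp
  then have eq: "(\<integral>\<^sup>+ x. e2ennreal (f x + ereal B) \<partial>M) + (\<integral>\<^sup>+ x. e2ennreal (- f x) \<partial>M) =
      (\<integral>\<^sup>+ x. e2ennreal (f x) \<partial>M) + ennreal B"
    by (simp add: nn_integral_add emeasure_space_1)
  have "(\<integral>\<^sup>+ x. e2ennreal (- f x) \<partial>M) \<le> (\<integral>\<^sup>+ x. ennreal B \<partial>M)"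
    using f by (intro nn_integral_mono) (metis e2ennreal_ereal e2ennreal_mono ereal_uminus_le_reorder)
  then have "(\<integral>\<^sup>+ x. e2ennreal (- f x) \<partial>M) < \<top>"
    by (simp add: emeasure_space_1 order_le_less_trans[OF _ ennreal_less_top])
  with eq B show ?thesis
    unfolding ereal_expectation_def
    by (cases "\<integral>\<^sup>+ x. e2ennreal (f x + ereal B) \<partial>M"; cases "\<integral>\<^sup>+ x. e2ennreal (f x) \<partial>M";
        cases "\<integral>\<^sup>+ x. e2ennreal (- f x) \<partial>M")
      (auto simp: ennreal_plus[symmetric] simp del: ennreal_plus)
qed

lemma liminf_add_ennreal:
  fixes a b :: "nat \<Rightarrow> ennreal"
  shows "liminf a + liminf b \<le> liminf (\<lambda>n. a n + b n)"
proof -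
  have "liminf a + liminf b = (SUP n. (INF m\<in>{n..}. a m) + (INF m\<in>{n..}. b m))"
    unfolding liminf_SUP_INF
    by (intro ennreal_SUP_add[symmetric]) (auto simp: incseq_def intro!: INF_superset_mono)
  also have "\<dots> \<le> liminf (\<lambda>n. a n + b n)"
    unfolding liminf_SUP_INF
    by (intro SUP_mono) (auto intro!: INF_greatest add_mono INF_lower)
  finally show ?thesis .
qed

text \<open>Induction over \<open>f\<close>: indicators reduce to \<open>emeasure_mixture\<close>,
  and both sides respect scaling, sums and monotone limits. It makes expected losses affine in the
  distribution.\<close>

lemma nn_integral_mixture:
  assumes [simp, measurable_cong]: "sets \<rho>' = sets \<rho>" and "f \<in> borel_measurable \<rho>"
  shows "(\<integral>\<^sup>+ x. f x \<partial>mixture \<gamma> \<rho> \<rho>') =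
    ennreal \<gamma> * (\<integral>\<^sup>+ x. f x \<partial>\<rho>) + ennreal (1 - \<gamma>) * (\<integral>\<^sup>+ x. f x \<partial>\<rho>')"
proof -
  have [simp, measurable_cong]: "sets (mixture \<gamma> \<rho> \<rho>') = sets \<rho>"
    by (simp add: mixture_def)
  have [simp]: "space \<rho>' = space \<rho>" "space (mixture \<gamma> \<rho> \<rho>') = space \<rho>"
    by (rule sets_eq_imp_space_eq, simp)+
  from assms(2) show ?thesis
  proof induction
    case (cong f g)
    then have "integral\<^sup>N m f = integral\<^sup>N m g" if "space m = space \<rho>" for m
      using that by (intro nn_integral_cong) auto
    with cong show ?case by simp
  next
    case (set A)
    then show ?case by (simp add: emeasure_mixture)
  next
    case (mult u c)
    then show ?case
      by (simp add: nn_integral_cmult distrib_left ac_simps)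
  next
    case (add u v)
    then show ?case
      by (simp add: nn_integral_add distrib_left ac_simps)
  next
    case (seq U)
    have inc: "incseq (\<lambda>i. c * (\<integral>\<^sup>+ x. U i x \<partial>m))" for c m
      using seq by (auto simp: incseq_def le_fun_def intro!: mult_left_mono nn_integral_mono)
    have "(\<integral>\<^sup>+ x. (SUP i. U i x) \<partial>m) = (SUP i. \<integral>\<^sup>+ x. U i x \<partial>m)"
      if "sets m = sets \<rho>" for m
    proof -
      have [measurable_cong]: "sets m = sets \<rho>" by fact
      show ?thesis
        using seq by (intro nn_integral_monotone_convergence_SUP) auto
    qed
    then show ?case
      using seq by (simp add: SUP_apply[abs_def] image_comp SUP_mult_left_ennreal ennreal_SUP_add[OF inc inc])
  qed
qed

section \<open>Probability densities and their limits in L1\<close>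

text \<open>Nonnegativity is imposed at every point rather than almost everywhere, so that \<phi> is
  only ever evaluated on [0, \<infinity>).\<close>

definition densities :: "'a measure \<Rightarrow> ('a \<Rightarrow> real) set" where
  "densities M = {f \<in> borel_measurable M. (\<forall>x. 0 \<le> f x) \<and> (\<integral>\<^sup>+ x. ennreal (f x) \<partial>M) = 1}"

lemma densitiesD:
  assumes "f \<in> densities M"
  shows "f \<in> borel_measurable M" "0 \<le> f x" "integrable M f" "integral\<^sup>L M f = 1"
    and "density M (\<lambda>x. ennreal (f x)) \<in> prob_measures M"
proof -
  from assms show f: "f \<in> borel_measurable M" "0 \<le> f x"
    and "density M (\<lambda>x. ennreal (f x)) \<in> prob_measures M"
    by (auto simp: densities_def space_prob_algebra emeasure_density intro!: prob_spaceI
        cong: nn_integral_cong)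
  have "has_bochner_integral M f 1"
    using assms by (intro has_bochner_integral_nn_integral) (auto simp: densities_def)
  then show "integrable M f" "integral\<^sup>L M f = 1"
    by (auto simp: has_bochner_integral_iff)
qed

lemma densitiesI:
  assumes "integrable M f" "integral\<^sup>L M f = 1" "\<And>x. 0 \<le> f x"
  shows "f \<in> densities M"
  using assms by (auto simp: densities_def nn_integral_eq_integral)

lemma (in prob_space) prob_measures_densityE:
  assumes \<rho>: "\<rho> \<in> prob_measures M" and ac: "absolutely_continuous M \<rho>"
  obtains f where "f \<in> densities M" "\<rho> = density M (\<lambda>x. ennreal (f x))"
proof -
  from \<rho> have s: "sets \<rho> = sets M" and "prob_space \<rho>"
    by (auto simp: space_prob_algebra)
  interpret \<rho>: prob_space \<rho> by fact
  obtain f where f: "f \<in> borel_measurable M" "AE x in M. RN_deriv M \<rho> x = ennreal (f x)"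
    "\<And>x. 0 \<le> f x"
    using real_RN_deriv[OF \<rho>.finite_measure_axioms ac s] by metis
  then have eq: "\<rho> = density M (\<lambda>x. ennreal (f x))"
    by (subst density_RN_deriv[OF ac s, symmetric]) (auto intro!: density_cong)
  have "(\<integral>\<^sup>+ x. ennreal (f x) \<partial>M) = emeasure \<rho> (space M)"
    using f by (subst eq) (auto simp: emeasure_density cong: nn_integral_cong)
  also have "\<dots> = 1"
    using \<rho>.emeasure_space_1 sets_eq_imp_space_eq[OF s] by simp
  finally show thesis
    using f eq that by (auto simp: densities_def)
qed

text \<open>Split the space into {g < f} and {f \<le> g}. On each part |f - g| integrates to the
  difference of the two measures of that part, and each difference is at most n.\<close>

lemma densities_L1_le:
  assumes f: "f \<in> densities M" and g: "g \<in> densities M"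
    and n: "\<And>A. A \<in> sets M \<Longrightarrow>
      \<bar>measure (density M (\<lambda>x. ennreal (f x))) A - measure (density M (\<lambda>x. ennreal (g x))) A\<bar> \<le> n"
  shows "(\<integral>x. \<bar>f x - g x\<bar> \<partial>M) \<le> 2 * n"
proof -
  note [measurable] = densitiesD(1)[OF f] densitiesD(1)[OF g]
  note [simp] = densitiesD(3)[OF f] densitiesD(3)[OF g]
  have meas: "measure (density M (\<lambda>x. ennreal (h x))) A = (\<integral>x. h x * indicator A x \<partial>M)"
    if h: "h \<in> densities M" and [measurable]: "A \<in> sets M" for h A
  proof -
    note [measurable] = densitiesD(1)[OF h]
    have "integrable M (\<lambda>x. h x * indicator A x)"
      using densitiesD(3)[OF h] by (rule integrable_real_mult_indicator[rotated]) simp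
    moreover have "ennreal (h x) * indicator A x = ennreal (h x * indicator A x)" for x
      by (auto split: split_indicator)
    ultimately show ?thesis
      using densitiesD(2)[OF h]
      by (simp add: measure_def emeasure_density nn_integral_eq_integral)
  qed
  define A where "A = {x \<in> space M. g x < f x}"
  define C where "C = {x \<in> space M. f x \<le> g x}"
  have [measurable]: "A \<in> sets M" "C \<in> sets M"
    unfolding A_def C_def by measurable
  have int: "integrable M (\<lambda>x. h x * indicator D x)"
    if "integrable M h" "D \<in> sets M" for h :: "'a \<Rightarrow> real" and D
    using that by (intro integrable_real_mult_indicator) auto
  have "(\<integral>x. \<bar>f x - g x\<bar> \<partial>M) =
      (\<integral>x. (f x * indicator A x - g x * indicator A x) +
        (g x * indicator C x - f x * indicator C x) \<partial>M)"
    by (intro Bochner_Integration.integral_cong) (auto simp: A_def C_def split: split_indicator)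
  also have "\<dots> = (measure (density M (\<lambda>x. ennreal (f x))) A - measure (density M (\<lambda>x. ennreal (g x))) A) +
      (measure (density M (\<lambda>x. ennreal (g x))) C - measure (density M (\<lambda>x. ennreal (f x))) C)"
    using f g by (simp add: meas int)
  also have "\<dots> \<le> 2 * n"
    using n[of A] n[of C] by auto
  finally show ?thesis .
qed

text \<open>As in the completeness proof of L1: the sum of |f (n + 1) - f n| has finite integral, so
  the telescoping series converges absolutely almost everywhere. The limit keeps mass 1 because
  every increment has integral 0.\<close>

lemma densities_summable_limit:
  assumes f: "\<And>n. f n \<in> densities M"
    and sum: "summable (\<lambda>n. \<integral>x. \<bar>f (Suc n) x - f n x\<bar> \<partial>M)"
  obtains g where "g \<in> densities M" "AE x in M. (\<lambda>n. f n x) \<longlonglongrightarrow> g x"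
proof -
  define d where "d n x = f (Suc n) x - f n x" for n x
  note [measurable] = densitiesD(1)[OF f]
  have f_int [simp]: "integrable M (f n)" for n
    by (rule densitiesD(3)[OF f])
  have [measurable]: "d n \<in> borel_measurable M" for n
    unfolding d_def by measurable
  have d: "integrable M (d n)" for n
    unfolding d_def by simp
  have "(\<integral>\<^sup>+ x. (\<Sum>n. ennreal (norm (d n x))) \<partial>M) = (\<Sum>n. \<integral>\<^sup>+ x. ennreal (norm (d n x)) \<partial>M)"
    by (intro nn_integral_suminf) auto
  also have "\<dots> = (\<Sum>n. ennreal (\<integral>x. norm (d n x) \<partial>M))"
    using d by (simp add: nn_integral_eq_integral)
  also have "\<dots> \<noteq> \<infinity>"
    using sum by (simp add: ennreal_suminf_neq_top d_def)
  finally have "AE x in M. (\<Sum>n. ennreal (norm (d n x))) \<noteq> \<infinity>"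
    by (intro nn_integral_PInf_AE) auto
  then have sum_d: "AE x in M. summable (\<lambda>n. norm (d n x))"
    by eventually_elim (auto intro!: summable_suminf_not_top)
  have sum': "summable (\<lambda>n. \<integral>x. norm (d n x) \<partial>M)"
    using sum by (simp add: d_def)
  define h where "h x = f 0 x + (\<Sum>n. d n x)" for x
  have h_int: "integrable M h"
    unfolding h_def using integrable_suminf[OF d sum_d sum'] by simp
  have "integral\<^sup>L M (d n) = 0" for n
    using densitiesD(4)[OF f] by (simp add: d_def[abs_def])
  then have "(\<integral>x. (\<Sum>n. d n x) \<partial>M) = 0"
    by (subst integral_suminf[OF d sum_d sum']) simp
  moreover have "integral\<^sup>L M h = integral\<^sup>L M (f 0) + (\<integral>x. (\<Sum>n. d n x) \<partial>M)"
    unfolding h_def by (intro Bochner_Integration.integral_add f_int integrable_suminf[OF d sum_d sum'])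
  ultimately have h_one: "integral\<^sup>L M h = 1"
    using densitiesD(4)[OF f, of 0] by simp
  have lim: "AE x in M. (\<lambda>n. f n x) \<longlonglongrightarrow> h x"
    using sum_d
  proof eventually_elim
    fix x assume "summable (\<lambda>n. norm (d n x))"
    then have "(\<lambda>n. \<Sum>i<n. d i x) \<longlonglongrightarrow> (\<Sum>n. d n x)"
      by (rule summable_LIMSEQ[OF summable_norm_cancel])
    then have "(\<lambda>n. f 0 x + (\<Sum>i<n. d i x)) \<longlonglongrightarrow> h x"
      unfolding h_def by (intro tendsto_intros)
    then show "(\<lambda>n. f n x) \<longlonglongrightarrow> h x"
      by (simp add: d_def sum_lessThan_telescope[of "\<lambda>n. f n x"])
  qed
  then have h_nonneg: "AE x in M. max 0 (h x) = h x"
  proof eventually_elim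
    fix x assume "(\<lambda>n. f n x) \<longlonglongrightarrow> h x"
    then have "0 \<le> h x"
      by (rule LIMSEQ_le_const) (use densitiesD(2)[OF f] in blast)
    then show "max 0 (h x) = h x" by simp
  qed
  show thesis
  proof
    \<comment> \<open>\<open>h\<close> is a limit of nonnegative values only almost everywhere; on
      the exceptional null set it may be negative, so it is cut off at 0 to meet the pointwise
      condition in \<open>densities\<close>.\<close>
    show "(\<lambda>x. max 0 (h x)) \<in> densities M"
    proof (rule densitiesI)
      have [measurable]: "h \<in> borel_measurable M"
        using h_int by (rule borel_measurable_integrable)
      have "integral\<^sup>L M (\<lambda>x. max 0 (h x)) = integral\<^sup>L M h"
        using h_nonneg by (intro integral_cong_AE) auto
      then show "integral\<^sup>L M (\<lambda>x. max 0 (h x)) = 1"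
        using h_one by simp
    qed (use h_int in auto)
    show "AE x in M. (\<lambda>n. f n x) \<longlonglongrightarrow> max 0 (h x)"
      using lim h_nonneg by eventually_elim simp
  qed
qed

section \<open>The divergence as a functional of the density\<close>

text \<open>The constant \<open>B\<close> makes \<phi> + B nonnegative, so that divergences become
  nonnegative integrals shifted by B and Fatou's lemma applies without integrability
  conditions.\<close>

locale lsc_divergence = prob_space M for M :: "'a measure" +
  fixes \<phi> :: "real \<Rightarrow> ereal" and B :: real
  assumes lsc: "lsc_nonneg \<phi>"
    and B: "0 \<le> B"
    and lower: "\<And>x. 0 \<le> x \<Longrightarrow> - ereal B \<le> \<phi> x"
begin

lemma measurable_shift [measurable]:
  assumes "f \<in> densities M"
  shows "(\<lambda>x. e2ennreal (\<phi> (f x) + ereal B)) \<in> borel_measurable M"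
proof -
  have [measurable]: "(\<lambda>x. \<phi> (f x)) \<in> borel_measurable M"
    using densitiesD(1,2)[OF assms] by (intro lsc_nonneg_measurable[OF lsc])
  show ?thesis by measurable
qed

lemma phi_divergence_density:
  assumes f: "f \<in> densities M"
  shows "phi_divergence \<phi> (density M (\<lambda>x. ennreal (f x))) M =
    enn2ereal (\<integral>\<^sup>+ x. e2ennreal (\<phi> (f x) + ereal B) \<partial>M) - ereal B"
proof -
  let ?\<rho> = "density M (\<lambda>x. ennreal (f x))"
  note [measurable] = densitiesD(1)[OF f]
  have "AE x in M. ennreal (f x) = RN_deriv M ?\<rho> x"
    by (rule RN_deriv_unique) auto
  then have RN: "AE x in M. enn2real (RN_deriv M ?\<rho> x) = f x"
    by eventually_elim (metis densitiesD(2)[OF f] enn2real_ennreal)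
  have ac: "absolutely_continuous M ?\<rho>"
    by (intro absolutely_continuousI_density) auto
  have [measurable]: "(\<lambda>x. \<phi> (enn2real (RN_deriv M ?\<rho> x))) \<in> borel_measurable M"
    by (intro lsc_nonneg_measurable[OF lsc]) auto
  have "phi_divergence \<phi> ?\<rho> M = enn2ereal (\<integral>\<^sup>+ x. e2ennreal (\<phi> (enn2real (RN_deriv M ?\<rho> x)) + ereal B) \<partial>M) - ereal B"
    unfolding phi_divergence_def if_P[OF ac]
    by (intro ereal_expectation_shift lower B) auto
  also have "(\<integral>\<^sup>+ x. e2ennreal (\<phi> (enn2real (RN_deriv M ?\<rho> x)) + ereal B) \<partial>M) =
      (\<integral>\<^sup>+ x. e2ennreal (\<phi> (f x) + ereal B) \<partial>M)"
    using RN by (intro nn_integral_cong_AE) (auto elim!: eventually_mono)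
  finally show ?thesis .
qed

text \<open>Jensen's inequality through the supporting line at 1: almost everywhere \<phi> (f) \<ge>
  c (f - 1), and the right-hand side has mean 0.\<close>

lemma phi_divergence_nonneg:
  assumes conv: "strictly_convex_nonneg \<phi>" and one: "\<phi> 1 = 0" and \<rho>: "\<rho> \<in> prob_measures M"
  shows "0 \<le> phi_divergence \<phi> \<rho> M"
proof (cases "phi_divergence \<phi> \<rho> M = \<infinity>")
  case False
  then have ac: "absolutely_continuous M \<rho>"
    by (auto simp: phi_divergence_def split: if_splits)
  obtain f where f: "f \<in> densities M" and \<rho>: "\<rho> = density M (\<lambda>x. ennreal (f x))"
    using prob_measures_densityE[OF \<rho> ac] .
  note [measurable] = densitiesD(1)[OF f]
  have "(\<integral>\<^sup>+ x. e2ennreal (\<phi> (f x) + ereal B) \<partial>M) \<noteq> \<infinity>"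
    using False unfolding \<rho> phi_divergence_density[OF f] by auto
  then have "AE x in M. e2ennreal (\<phi> (f x) + ereal B) \<noteq> \<infinity>"
    using f by (intro nn_integral_PInf_AE) auto
  then have "AE x in M. \<phi> (f x) \<noteq> \<infinity>"
    by eventually_elim auto
  from strictly_convex_nonneg_tangent_AE[OF conv one densitiesD(3,4)[OF f] densitiesD(2)[OF f] this]
  obtain c where c: "AE x in M. ereal (c * (f x - 1)) \<le> \<phi> (f x)"
    by blast
  \<comment> \<open>The shifted line has integral B. Its positive part has at least this integral
    and still lies below \<phi> (f) + B, which is nonnegative; this moves the comparison into
    nonnegative integrals.\<close>
  have int: "integrable M (\<lambda>x. c * (f x - 1) + B)" "(\<integral>x. c * (f x - 1) + B \<partial>M) = B"
    using densitiesD(3,4)[OF f] by (auto simp: prob_space)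
  then have "B \<le> (\<integral>x. max 0 (c * (f x - 1) + B) \<partial>M)"
    using integral_mono[OF int(1) integrable_max[OF integrable_zero int(1)]] by simp
  then have "ennreal B \<le> ennreal (\<integral>x. max 0 (c * (f x - 1) + B) \<partial>M)"
    by (rule ennreal_leI)
  also have "\<dots> = (\<integral>\<^sup>+ x. ennreal (max 0 (c * (f x - 1) + B)) \<partial>M)"
    using int by (intro nn_integral_eq_integral[symmetric] integrable_max) auto
  also have "\<dots> = (\<integral>\<^sup>+ x. ennreal (c * (f x - 1) + B) \<partial>M)"
    by (intro nn_integral_cong) (simp add: max_def ennreal_neg)
  also have "\<dots> \<le> (\<integral>\<^sup>+ x. e2ennreal (\<phi> (f x) + ereal B) \<partial>M)"
    using c
  proof (intro nn_integral_mono_AE, eventually_elim)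
    fix x assume "ereal (c * (f x - 1)) \<le> \<phi> (f x)"
    then have "ereal (c * (f x - 1) + B) \<le> \<phi> (f x) + ereal B"
      by (metis add_right_mono plus_ereal.simps(1))
    then show "ennreal (c * (f x - 1) + B) \<le> e2ennreal (\<phi> (f x) + ereal B)"
      by (metis e2ennreal_ereal e2ennreal_mono)
  qed
  finally have "ereal B \<le> enn2ereal (\<integral>\<^sup>+ x. e2ennreal (\<phi> (f x) + ereal B) \<partial>M)"
    using B by (metis enn2ereal_ennreal less_eq_ennreal.rep_eq)
  then show ?thesis
    unfolding \<rho> phi_divergence_density[OF f] by (simp add: ereal_le_minus_iff)
qed simp

text \<open>Pointwise, the loss term is continuous in the density and the penalty lower
  semicontinuous, so the integrand at the limit lies below the liminf; Fatou's lemma carries this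
  through the integral.\<close>

lemma penalised_integral_lsc:
  assumes f: "\<And>n. f n \<in> densities M" and g: "g \<in> densities M"
    and lim: "AE x in M. (\<lambda>n. f n x) \<longlonglongrightarrow> g x"
    and [measurable]: "w \<in> borel_measurable M"
  shows "(\<integral>\<^sup>+ x. ennreal (w x) * ennreal (g x) + c * e2ennreal (\<phi> (g x) + ereal B) \<partial>M) \<le>
    liminf (\<lambda>n. \<integral>\<^sup>+ x. ennreal (w x) * ennreal (f n x) + c * e2ennreal (\<phi> (f n x) + ereal B) \<partial>M)"
proof -
  let ?H = "\<lambda>f x. ennreal (w x) * ennreal (f x) + c * e2ennreal (\<phi> (f x) + ereal B)"
  note [measurable] = densitiesD(1)[OF f] measurable_shift[OF f]
  have "(\<integral>\<^sup>+ x. ?H g x \<partial>M) \<le> (\<integral>\<^sup>+ x. liminf (\<lambda>n. ?H (f n) x) \<partial>M)"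
    using lim
  proof (intro nn_integral_mono_AE, eventually_elim)
    fix x assume lim: "(\<lambda>n. f n x) \<longlonglongrightarrow> g x"
    have "ennreal (w x) * ennreal (g x) = liminf (\<lambda>n. ennreal (w x) * ennreal (f n x))"
      by (intro lim_imp_Liminf[symmetric] ennreal_tendsto_cmult tendsto_ennrealI lim) auto
    moreover have "c * e2ennreal (\<phi> (g x) + ereal B) \<le> liminf (\<lambda>n. c * e2ennreal (\<phi> (f n x) + ereal B))"
    proof -
      have "\<phi> (g x) + ereal B \<le> liminf (\<lambda>n. \<phi> (f n x)) + ereal B"
        using lsc_nonneg_liminf[OF lsc lim] densitiesD(2)[OF f] by (intro add_right_mono) auto
      also have "\<dots> = liminf (\<lambda>n. \<phi> (f n x) + ereal B)"
        by (intro Liminf_add_ereal_right[symmetric]) auto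
      finally have "e2ennreal (\<phi> (g x) + ereal B) \<le> e2ennreal (liminf (\<lambda>n. \<phi> (f n x) + ereal B))"
        by (rule e2ennreal_mono)
      \<comment> \<open>\<open>e2ennreal\<close> is continuous and monotone and therefore commutes
        with liminf.\<close>
      also have "\<dots> = liminf (\<lambda>n. e2ennreal (\<phi> (f n x) + ereal B))"
        by (intro Liminf_compose_continuous_mono[symmetric] continuous_on_e2ennreal)
          (auto simp: mono_def intro: e2ennreal_mono)
      finally have "c * e2ennreal (\<phi> (g x) + ereal B) \<le> c * liminf (\<lambda>n. e2ennreal (\<phi> (f n x) + ereal B))"
        by (rule mult_left_mono) simp
      also have "\<dots> \<le> liminf (\<lambda>n. c * e2ennreal (\<phi> (f n x) + ereal B))"
        unfolding liminf_SUP_INF SUP_mult_left_ennreal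
        by (intro SUP_mono) (auto intro!: INF_greatest mult_left_mono INF_lower)
      finally show ?thesis .
    qed
    ultimately have "?H g x \<le> liminf (\<lambda>n. ennreal (w x) * ennreal (f n x)) +
        liminf (\<lambda>n. c * e2ennreal (\<phi> (f n x) + ereal B))"
      by (simp add: add_mono)
    also have "\<dots> \<le> liminf (\<lambda>n. ?H (f n) x)"
      by (rule liminf_add_ennreal)
    finally show "?H g x \<le> liminf (\<lambda>n. ?H (f n) x)" .
  qed
  also have "\<dots> \<le> liminf (\<lambda>n. \<integral>\<^sup>+ x. ?H (f n) x \<partial>M)"
    by (intro nn_integral_liminf) measurable
  finally show ?thesis .
qed

text \<open>Merges losses and penalty into the single integral treated by
  \<open>penalised_integral_lsc\<close>; the constant B / \<eta> is the shift of the divergence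
  after division by \<eta>.\<close>

lemma ftrl_objective_density:
  assumes f: "f \<in> densities M" and eta: "0 < \<eta>"
    and [measurable]: "\<And>t. loss t \<in> borel_measurable M"
    and nonneg: "\<And>t x. x \<in> space M \<Longrightarrow> 0 \<le> loss t x"
  shows "ftrl_objective loss \<phi> M \<eta> t (density M (\<lambda>x. ennreal (f x))) =
    enn2ereal (\<integral>\<^sup>+ x. ennreal (\<Sum>s = 1..<t. loss s x) * ennreal (f x) +
      ennreal (1 / \<eta>) * e2ennreal (\<phi> (f x) + ereal B) \<partial>M) - ereal (B / \<eta>)"
proof -
  note [measurable] = densitiesD(1)[OF f] measurable_shift[OF f]
  define Q where "Q = (\<integral>\<^sup>+ x. e2ennreal (\<phi> (f x) + ereal B) \<partial>M)"
  have "exp_loss loss s (density M (\<lambda>x. ennreal (f x))) =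
      enn2ereal (\<integral>\<^sup>+ x. ennreal (loss s x) * ennreal (f x) \<partial>M)" for s
    unfolding exp_loss_def using nonneg
    by (subst ereal_expectation_nonneg) (auto simp: nn_integral_density mult.commute)
  then have "(\<Sum>s = 1..<t. exp_loss loss s (density M (\<lambda>x. ennreal (f x)))) =
      enn2ereal (\<Sum>s = 1..<t. \<integral>\<^sup>+ x. ennreal (loss s x) * ennreal (f x) \<partial>M)"
    by simp
  also have "(\<Sum>s = 1..<t. \<integral>\<^sup>+ x. ennreal (loss s x) * ennreal (f x) \<partial>M) =
      (\<integral>\<^sup>+ x. (\<Sum>s = 1..<t. ennreal (loss s x) * ennreal (f x)) \<partial>M)"
    by (intro nn_integral_sum[symmetric]) auto
  also have "\<dots> = (\<integral>\<^sup>+ x. ennreal (\<Sum>s = 1..<t. loss s x) * ennreal (f x) \<partial>M)"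
    using nonneg by (intro nn_integral_cong) (simp add: sum_distrib_right[symmetric] sum_ennreal)
  finally have E: "(\<Sum>s = 1..<t. exp_loss loss s (density M (\<lambda>x. ennreal (f x)))) =
      enn2ereal (\<integral>\<^sup>+ x. ennreal (\<Sum>s = 1..<t. loss s x) * ennreal (f x) \<partial>M)" .
  have D: "phi_divergence \<phi> (density M (\<lambda>x. ennreal (f x))) M / ereal \<eta> =
      enn2ereal (ennreal (1 / \<eta>) * Q) - ereal (B / \<eta>)"
    unfolding phi_divergence_density[OF f] Q_def[symmetric] using eta
    by (cases Q) (auto simp: ennreal_mult[symmetric] diff_divide_distrib ennreal_mult_top)
  have "(\<integral>\<^sup>+ x. ennreal (\<Sum>s = 1..<t. loss s x) * ennreal (f x) +
      ennreal (1 / \<eta>) * e2ennreal (\<phi> (f x) + ereal B) \<partial>M) =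
      (\<integral>\<^sup>+ x. ennreal (\<Sum>s = 1..<t. loss s x) * ennreal (f x) \<partial>M) + ennreal (1 / \<eta>) * Q"
    unfolding Q_def by (subst nn_integral_add) (auto simp: nn_integral_cmult)
  then show ?thesis
    unfolding ftrl_objective_def E D
    by (simp add: plus_ennreal.rep_eq minus_ereal_def add.assoc)
qed

end

section \<open>Mixtures and differences of probability measures\<close>

lemma prob_measures_mixture:
  assumes "\<rho> \<in> prob_measures M" "\<rho>' \<in> prob_measures M" "0 \<le> \<gamma>" "\<gamma> \<le> 1"
  shows "mixture \<gamma> \<rho> \<rho>' \<in> prob_measures M"
proof -
  have "sets \<rho> = sets M" "sets \<rho>' = sets M"
    using assms(1,2) by (auto simp: space_prob_algebra)
  moreover have "sets (mixture \<gamma> \<rho> \<rho>') = sets \<rho>"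
    by (simp add: mixture_def)
  ultimately have s: "sets \<rho> = sets M" "sets \<rho>' = sets M" "sets (mixture \<gamma> \<rho> \<rho>') = sets M"
    by simp_all
  note sp = s[THEN sets_eq_imp_space_eq]
  have "emeasure (mixture \<gamma> \<rho> \<rho>') (space M) = ennreal \<gamma> + ennreal (1 - \<gamma>)"
    using in_space_prob_algebra[OF assms(1)] in_space_prob_algebra[OF assms(2)] s
    by (simp add: emeasure_mixture)
  also have "\<dots> = 1"
    using assms(3,4) by (simp add: ennreal_plus[symmetric] del: ennreal_plus)
  finally show ?thesis
    using s sp by (auto simp: space_prob_algebra intro: prob_spaceI)
qed

lemma diff_measures_signed:
  assumes "\<rho> \<in> prob_measures M" "\<rho>' \<in> prob_measures M"
  shows "diff_measures \<rho> \<rho>' \<in> signed_measures M"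
proof -
  have s: "sets \<rho> = sets M" "sets \<rho>' = sets M"
    and "prob_space \<rho>" "prob_space \<rho>'"
    using assms by (auto simp: space_prob_algebra)
  interpret \<rho>: prob_space \<rho> by fact
  interpret \<rho>': prob_space \<rho>' by fact
  show ?thesis
    unfolding signed_measures_def diff_measures_def
    by (auto simp: s measure_notin_sets intro!: sums_diff \<rho>.finite_measure_UNION \<rho>'.finite_measure_UNION)
qed

section \<open>Strong convexity of the penalised loss\<close>

locale ftrl = lsc_divergence \<pi> \<phi> B
  for \<pi> :: "'a measure" and \<phi> B +
  fixes \<eta> \<alpha> L :: real
    and loss :: "nat \<Rightarrow> 'a \<Rightarrow> real"
    and N :: "('a set \<Rightarrow> real) \<Rightarrow> ennreal"
  assumes eta: "0 < \<eta>" and alpha: "0 < \<alpha>"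
    and loss_measurable [measurable]: "\<And>t. loss t \<in> borel_measurable \<pi>"
    and loss_nonneg: "\<And>t \<theta>. \<theta> \<in> space \<pi> \<Longrightarrow> 0 \<le> loss t \<theta>"
    and loss_integrable: "\<And>t. integrable \<pi> (loss t)"
    and phi_convex: "strictly_convex_nonneg \<phi>"
    and phi_one: "\<phi> 1 = 0"
    and norm_tv: "\<And>\<nu>. \<nu> \<in> signed_measures \<pi> \<Longrightarrow> tv_norm \<pi> \<nu> \<le> N \<nu>"
    and loss_lipschitz: "\<And>t \<rho> \<rho>'. \<rho> \<in> finite_div_measures \<phi> \<pi> \<Longrightarrow> \<rho>' \<in> finite_div_measures \<phi> \<pi> \<Longrightarrow>
        \<bar>exp_loss loss t \<rho> - exp_loss loss t \<rho>'\<bar> \<le> ereal L * enn2ereal (N (diff_measures \<rho> \<rho>'))"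
    and div_strongly_convex: "\<And>\<gamma> \<rho> \<rho>'. \<gamma> \<in> {0..1} \<Longrightarrow>
        \<rho> \<in> finite_div_measures \<phi> \<pi> \<Longrightarrow> \<rho>' \<in> finite_div_measures \<phi> \<pi> \<Longrightarrow>
        phi_divergence \<phi> (mixture \<gamma> \<rho> \<rho>') \<pi>
          \<le> ereal \<gamma> * phi_divergence \<phi> \<rho> \<pi> + ereal (1 - \<gamma>) * phi_divergence \<phi> \<rho>' \<pi>
            - ereal (\<alpha> / 2 * \<gamma> * (1 - \<gamma>)) * (enn2ereal (N (diff_measures \<rho> \<rho>')))\<^sup>2"
begin

abbreviation "F \<equiv> finite_div_measures \<phi> \<pi>"
abbreviation "halfway \<rho> \<rho>' \<equiv> mixture (1 / 2) \<rho> \<rho>'"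

text \<open>Real-valued counterparts of the extended-real quantities. They are faithful on
  \<open>F\<close>, as shown in \<open>F_div\<close>, \<open>F_loss\<close> and
  \<open>midpoint_step\<close>, so the estimates below are plain real arithmetic.\<close>

definition "divergence \<rho> = real_of_ereal (phi_divergence \<phi> \<rho> \<pi>)"
definition "avg_loss t \<rho> = real_of_ereal (exp_loss loss t \<rho>)"
definition "gap \<rho> \<rho>' = enn2real (N (diff_measures \<rho> \<rho>'))"
definition "objective t \<rho> = (\<Sum>s = 1..<t. avg_loss s \<rho>) + divergence \<rho> / \<eta>"

lemma F_prob: "\<rho> \<in> F \<Longrightarrow> \<rho> \<in> prob_measures \<pi>"
  by (simp add: finite_div_measures_def)

lemma F_div:
  assumes "\<rho> \<in> F"
  shows "phi_divergence \<phi> \<rho> \<pi> = ereal (divergence \<rho>)" "0 \<le> divergence \<rho>"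
proof -
  have "0 \<le> phi_divergence \<phi> \<rho> \<pi>" "phi_divergence \<phi> \<rho> \<pi> < \<infinity>"
    using assms phi_divergence_nonneg[OF phi_convex phi_one] by (auto simp: finite_div_measures_def)
  then show "phi_divergence \<phi> \<rho> \<pi> = ereal (divergence \<rho>)" "0 \<le> divergence \<rho>"
    unfolding divergence_def by (cases "phi_divergence \<phi> \<rho> \<pi>"; simp)+
qed

text \<open>The prior has density 1 and therefore divergence 0. It serves as the reference point
  that makes \<open>F\<close> nonempty and, in \<open>F_loss\<close>, anchors the losses at a finite
  value.\<close>

lemma prior_in_F: "\<pi> \<in> F"
proof -
  have one: "(\<lambda>_. 1) \<in> densities \<pi>"
    by (auto simp: densities_def emeasure_space_1)
  have "phi_divergence \<phi> (density \<pi> (\<lambda>_. ennreal 1)) \<pi> = 0"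
    using phi_divergence_density[OF one] B by (simp add: phi_one emeasure_space_1)
  then show ?thesis
    by (simp add: finite_div_measures_def space_prob_algebra prob_space_axioms density_1)
qed

lemma exp_loss_eq:
  assumes "\<rho> \<in> prob_measures \<pi>"
  shows "exp_loss loss t \<rho> = enn2ereal (\<integral>\<^sup>+ x. ennreal (loss t x) \<partial>\<rho>)"
  unfolding exp_loss_def using loss_nonneg assms
  by (subst ereal_expectation_nonneg) (auto simp: space_prob_algebra dest: sets_eq_imp_space_eq)

lemma exp_loss_nonneg: "\<rho> \<in> prob_measures \<pi> \<Longrightarrow> 0 \<le> exp_loss loss t \<rho>"
  by (simp add: exp_loss_eq)

lemma gap_nonneg: "0 \<le> gap \<rho> \<rho>'"
  by (simp add: gap_def)

text \<open>Strong convexity at \<gamma> = 1/2, where \<alpha> / 2 * \<gamma> * (1 - \<gamma>) =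
  \<alpha> / 8.\<close>

lemma midpoint_step:
  assumes \<rho>: "\<rho> \<in> F" "\<rho>' \<in> F"
  shows "halfway \<rho> \<rho>' \<in> F" "N (diff_measures \<rho> \<rho>') = ennreal (gap \<rho> \<rho>')"
    and "divergence (halfway \<rho> \<rho>') \<le> (divergence \<rho> + divergence \<rho>') / 2 - \<alpha> / 8 * (gap \<rho> \<rho>')\<^sup>2"
proof -
  let ?N = "N (diff_measures \<rho> \<rho>')"
  have P: "halfway \<rho> \<rho>' \<in> prob_measures \<pi>"
    using \<rho>[THEN F_prob] by (intro prob_measures_mixture) auto
  have le: "phi_divergence \<phi> (halfway \<rho> \<rho>') \<pi> \<le>
      ereal ((divergence \<rho> + divergence \<rho>') / 2) - ereal (\<alpha> / 8) * (enn2ereal ?N)\<^sup>2"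
    using div_strongly_convex[of "1 / 2" \<rho> \<rho>'] \<rho> by (simp add: F_div add_divide_distrib)
  have nn: "0 \<le> phi_divergence \<phi> (halfway \<rho> \<rho>') \<pi>"
    by (rule phi_divergence_nonneg[OF phi_convex phi_one P])
  \<comment> \<open>Were the norm infinite, the bound just obtained would be -\<infinity>, against
    the nonnegativity of the divergence.\<close>
  show N: "?N = ennreal (gap \<rho> \<rho>')"
  proof (cases ?N)
    case top
    then show ?thesis
      using order_trans[OF nn le] alpha by (simp add: power2_eq_square)
  qed (simp add: gap_def)
  then have le: "phi_divergence \<phi> (halfway \<rho> \<rho>') \<pi> \<le>
      ereal ((divergence \<rho> + divergence \<rho>') / 2 - \<alpha> / 8 * (gap \<rho> \<rho>')\<^sup>2)"
    using le gap_nonneg by (simp add: power2_eq_square)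
  then show "halfway \<rho> \<rho>' \<in> F"
    using P by (auto simp: finite_div_measures_def)
  from F_div(1)[OF this] le
  show "divergence (halfway \<rho> \<rho>') \<le> (divergence \<rho> + divergence \<rho>') / 2 - \<alpha> / 8 * (gap \<rho> \<rho>')\<^sup>2"
    by simp
qed

lemma measure_diff_le_gap:
  assumes \<rho>: "\<rho> \<in> F" "\<rho>' \<in> F" and A: "A \<in> sets \<pi>"
  shows "\<bar>measure \<rho> A - measure \<rho>' A\<bar> \<le> gap \<rho> \<rho>'"
proof -
  have "ennreal \<bar>measure \<rho> A - measure \<rho>' A\<bar> \<le> tv_norm \<pi> (diff_measures \<rho> \<rho>')"
    unfolding tv_norm_def using A by (intro SUP_upper2[of A]) (auto simp: diff_measures_def)
  also have "\<dots> \<le> N (diff_measures \<rho> \<rho>')"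
    using \<rho>[THEN F_prob] by (intro norm_tv diff_measures_signed)
  also have "\<dots> = ennreal (gap \<rho> \<rho>')"
    by (rule midpoint_step(2)[OF \<rho>])
  finally show ?thesis
    using gap_nonneg by simp
qed

text \<open>The gap dominates the total variation distance, so the two measures agree on every
  measurable set.\<close>

lemma gap_eq_0:
  assumes \<rho>: "\<rho> \<in> F" "\<rho>' \<in> F" and "gap \<rho> \<rho>' = 0"
  shows "\<rho> = \<rho>'"
proof -
  have s: "sets \<rho> = sets \<pi>" "sets \<rho>' = sets \<pi>" and "prob_space \<rho>" "prob_space \<rho>'"
    using \<rho>[THEN F_prob] by (auto simp: space_prob_algebra)
  interpret \<rho>: prob_space \<rho> by fact
  interpret \<rho>': prob_space \<rho>' by fact
  show ?thesis
  proof (rule measure_eqI)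
    fix A assume "A \<in> sets \<rho>"
    then have "measure \<rho> A = measure \<rho>' A"
      using measure_diff_le_gap[OF \<rho>, of A] assms(3) s by simp
    then show "emeasure \<rho> A = emeasure \<rho>' A"
      by (simp add: \<rho>.emeasure_eq_measure \<rho>'.emeasure_eq_measure)
  qed (simp add: s)
qed

text \<open>The expected loss under the prior is finite by integrability, and the Lipschitz bound
  transfers finiteness to every member of \<open>F\<close>, whose gap to the prior is
  finite.\<close>

lemma F_loss:
  assumes "\<rho> \<in> F"
  shows "exp_loss loss t \<rho> = ereal (avg_loss t \<rho>)" "0 \<le> avg_loss t \<rho>"
proof -
  have "(\<integral>\<^sup>+ x. ennreal (loss t x) \<partial>\<pi>) = ennreal (\<integral>x. loss t x \<partial>\<pi>)"
    using loss_nonneg by (intro nn_integral_eq_integral loss_integrable) auto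
  then have \<pi>: "\<bar>exp_loss loss t \<pi>\<bar> \<noteq> \<infinity>"
    by (simp add: exp_loss_eq[OF F_prob[OF prior_in_F]])
  have "\<bar>exp_loss loss t \<rho> - exp_loss loss t \<pi>\<bar> \<le> ereal (L * gap \<rho> \<pi>)"
    using loss_lipschitz[OF assms prior_in_F, of t] midpoint_step(2)[OF assms prior_in_F] gap_nonneg
    by simp
  then show "exp_loss loss t \<rho> = ereal (avg_loss t \<rho>)" "0 \<le> avg_loss t \<rho>"
    using \<pi> exp_loss_nonneg[OF F_prob[OF assms], of t]
    unfolding avg_loss_def by (cases "exp_loss loss t \<rho>"; cases "exp_loss loss t \<pi>"; auto)+
qed

lemma avg_loss_lipschitz:
  assumes "\<rho> \<in> F" "\<rho>' \<in> F"
  shows "\<bar>avg_loss t \<rho> - avg_loss t \<rho>'\<bar> \<le> L * gap \<rho> \<rho>'"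
  using loss_lipschitz[OF assms, of t] midpoint_step(2)[OF assms] gap_nonneg
  by (simp add: F_loss assms)

lemma avg_loss_midpoint:
  assumes \<rho>: "\<rho> \<in> F" "\<rho>' \<in> F"
  shows "avg_loss t (halfway \<rho> \<rho>') = (avg_loss t \<rho> + avg_loss t \<rho>') / 2"
proof -
  have s: "sets \<rho> = sets \<pi>" "sets \<rho>' = sets \<pi>"
    using \<rho>[THEN F_prob] by (auto simp: space_prob_algebra)
  note [measurable_cong] = s(1)
  have eq: "(\<integral>\<^sup>+ x. ennreal (loss t x) \<partial>\<mu>) = ennreal (avg_loss t \<mu>)" if "\<mu> \<in> F" for \<mu>
    using F_loss[OF that, of t] exp_loss_eq[OF F_prob[OF that], of t]
    by (metis e2ennreal_enn2ereal e2ennreal_ereal)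
  have "(\<integral>\<^sup>+ x. ennreal (loss t x) \<partial>halfway \<rho> \<rho>') =
      ennreal (1 / 2) * (\<integral>\<^sup>+ x. ennreal (loss t x) \<partial>\<rho>) +
      ennreal (1 - 1 / 2) * (\<integral>\<^sup>+ x. ennreal (loss t x) \<partial>\<rho>')"
    by (intro nn_integral_mixture) (auto simp: s)
  then have "ennreal (avg_loss t (halfway \<rho> \<rho>')) = ennreal ((avg_loss t \<rho> + avg_loss t \<rho>') / 2)"
    using \<rho> midpoint_step(1)[OF \<rho>] F_loss(2)
    by (simp add: eq ennreal_mult[symmetric] ennreal_plus[symmetric] add_divide_distrib
        del: ennreal_plus ennreal_half)
  then show ?thesis
    using \<rho> midpoint_step(1)[OF \<rho>] F_loss(2) by (subst (asm) ennreal_inj) auto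
qed

lemma ftrl_objective_F:
  assumes "\<rho> \<in> F"
  shows "ftrl_objective loss \<phi> \<pi> \<eta> t \<rho> = ereal (objective t \<rho>)"
  using eta by (simp add: ftrl_objective_def objective_def F_loss[OF assms] F_div[OF assms])

lemma objective_nonneg: "\<rho> \<in> F \<Longrightarrow> 0 \<le> objective t \<rho>"
  unfolding objective_def using eta F_loss(2) F_div(2) by (intro add_nonneg_nonneg sum_nonneg) auto

lemma ftrl_objective_not_F:
  assumes "\<rho> \<in> prob_measures \<pi>" "\<rho> \<notin> F"
  shows "ftrl_objective loss \<phi> \<pi> \<eta> t \<rho> = \<infinity>" "phi_divergence \<phi> \<rho> \<pi> = \<infinity>"
proof -
  show "phi_divergence \<phi> \<rho> \<pi> = \<infinity>"
    using assms by (simp add: finite_div_measures_def)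
  moreover have "0 \<le> (\<Sum>s = 1..<t. exp_loss loss s \<rho>)"
    using exp_loss_nonneg[OF assms(1)] by (intro sum_nonneg)
  ultimately show "ftrl_objective loss \<phi> \<pi> \<eta> t \<rho> = \<infinity>"
    using eta by (auto simp: ftrl_objective_def)
qed

text \<open>Expected losses are affine at the midpoint, so the whole curvature comes from the
  divergence, divided by \<eta>.\<close>

lemma objective_midpoint:
  assumes \<rho>: "\<rho> \<in> F" "\<rho>' \<in> F"
  shows "objective t (halfway \<rho> \<rho>') \<le>
    (objective t \<rho> + objective t \<rho>') / 2 - \<alpha> / (8 * \<eta>) * (gap \<rho> \<rho>')\<^sup>2"
proof -
  have "divergence (halfway \<rho> \<rho>') / \<eta> \<le> ((divergence \<rho> + divergence \<rho>') / 2 - \<alpha> / 8 * (gap \<rho> \<rho>')\<^sup>2) / \<eta>"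
    using midpoint_step(3)[OF \<rho>] eta by (intro divide_right_mono) auto
  also have "\<dots> = (divergence \<rho> / \<eta> + divergence \<rho>' / \<eta>) / 2 - \<alpha> / (8 * \<eta>) * (gap \<rho> \<rho>')\<^sup>2"
    by (simp add: diff_divide_distrib add_divide_distrib mult.commute)
  finally show ?thesis
    by (simp add: objective_def avg_loss_midpoint[OF \<rho>] sum_divide_distrib[symmetric] sum.distrib add_divide_distrib)
qed

text \<open>The midpoint value is at least that of the minimiser \<rho>; inserting this into
  \<open>objective_midpoint\<close> and doubling turns \<alpha> / (8 \<eta>) into \<alpha> / (4
  \<eta>).\<close>

lemma objective_growth:
  assumes \<rho>: "\<rho> \<in> F" and min: "\<And>\<mu>. \<mu> \<in> F \<Longrightarrow> objective t \<rho> \<le> objective t \<mu>" and \<rho>': "\<rho>' \<in> F"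
  shows "objective t \<rho> + \<alpha> / (4 * \<eta>) * (gap \<rho> \<rho>')\<^sup>2 \<le> objective t \<rho>'"
  using objective_midpoint[OF \<rho> \<rho>', of t] min[OF midpoint_step(1)[OF \<rho> \<rho>']]
  by (simp add: field_simps)

section \<open>Existence and uniqueness of the minimiser\<close>

lemma objective_minimizer: "\<exists>\<rho>\<in>F. \<forall>\<mu>\<in>F. objective t \<rho> \<le> objective t \<mu>"
proof -
  define m where "m = Inf (objective t ` F)"
  have bdd: "bdd_below (objective t ` F)"
    using objective_nonneg by (intro bdd_belowI2[of _ 0]) auto
  have m_le: "m \<le> objective t \<mu>" if "\<mu> \<in> F" for \<mu>
    unfolding m_def using bdd that by (rule cINF_lower)
  have m_nonneg: "0 \<le> m"
    unfolding m_def using prior_in_F objective_nonneg by (intro cINF_greatest) auto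
  have "\<exists>\<rho>\<in>F. objective t \<rho> < m + (1 / 4) ^ k" for k :: nat
    using bdd prior_in_F unfolding m_def
    by (subst cINF_less_iff[symmetric]) (auto simp: less_add_same_cancel1)
  then obtain r where r: "\<And>k::nat. r k \<in> F" "\<And>k. objective t (r k) < m + (1 / 4) ^ k"
    by metis
  \<comment> \<open>The midpoint of two consecutive points has value at least \<open>m\<close>, so
    the squared gap is at most 8 \<eta> / \<alpha> times their mean excess over \<open>m\<close>.
    The square root turns 4^-k into the summable 2^-k.\<close>
  have gap_r: "gap (r (Suc k)) (r k) \<le> sqrt (8 * \<eta> / \<alpha>) * (1 / 2) ^ k" for k
  proof (rule power2_le_imp_le)
    have "\<alpha> / (8 * \<eta>) * (gap (r (Suc k)) (r k))\<^sup>2 \<le>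
        (objective t (r (Suc k)) + objective t (r k)) / 2 - m"
      using objective_midpoint[OF r(1) r(1), of t "Suc k" k]
        m_le[OF midpoint_step(1)[OF r(1) r(1)], of "Suc k" k] by simp
    also have "\<dots> \<le> (1 / 4) ^ k"
    proof -
      have "(1 / 4 :: real) ^ Suc k \<le> (1 / 4) ^ k"
        by (rule power_decreasing) auto
      then have "objective t (r (Suc k)) \<le> m + (1 / 4) ^ k"
        by (rule order_trans[OF less_imp_le[OF r(2)] add_left_mono])
      moreover have "(x + y) / 2 - m \<le> q" if "x \<le> m + q" "y \<le> m + q" for x y q :: real
        using that by argo
      ultimately show ?thesis
        using less_imp_le[OF r(2)] by blast
    qed
    finally have "(gap (r (Suc k)) (r k))\<^sup>2 \<le> 8 * \<eta> / \<alpha> * (1 / 4) ^ k"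
      using eta alpha by (simp add: field_simps)
    also have "\<dots> = (sqrt (8 * \<eta> / \<alpha>) * (1 / 2) ^ k)\<^sup>2"
    proof -
      have "((1 / 2) ^ k)\<^sup>2 = (1 / 4 :: real) ^ k"
        by (simp add: power2_eq_square flip: power_mult_distrib)
      then show ?thesis
        using eta alpha by (simp add: power_mult_distrib)
    qed
    finally show "(gap (r (Suc k)) (r k))\<^sup>2 \<le> (sqrt (8 * \<eta> / \<alpha>) * (1 / 2) ^ k)\<^sup>2" .
  qed (use eta alpha in auto)
  \<comment> \<open>Finite divergence forces absolute continuity, since the divergence is
    \<infinity> by definition otherwise.\<close>
  have "\<exists>f\<in>densities \<pi>. r k = density \<pi> (\<lambda>x. ennreal (f x))" for k
  proof -
    have "absolutely_continuous \<pi> (r k)"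
      using r(1)[of k] by (auto simp: finite_div_measures_def phi_divergence_def split: if_splits)
    then show ?thesis
      using prob_measures_densityE[OF F_prob[OF r(1)]] by metis
  qed
  then obtain f where f: "\<And>k. f k \<in> densities \<pi>" "\<And>k. r k = density \<pi> (\<lambda>x. ennreal (f k x))"
    by metis
  have L1: "(\<integral>x. \<bar>f (Suc k) x - f k x\<bar> \<partial>\<pi>) \<le> 2 * (sqrt (8 * \<eta> / \<alpha>) * (1 / 2) ^ k)" for k
  proof (rule densities_L1_le[OF f(1) f(1)])
    fix A assume A: "A \<in> sets \<pi>"
    show "\<bar>measure (density \<pi> (\<lambda>x. ennreal (f (Suc k) x))) A - measure (density \<pi> (\<lambda>x. ennreal (f k x))) A\<bar>
        \<le> sqrt (8 * \<eta> / \<alpha>) * (1 / 2) ^ k"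
      unfolding f(2)[symmetric]
      by (rule order_trans[OF measure_diff_le_gap[OF r(1) r(1) A] gap_r])
  qed
  have geometric: "summable (\<lambda>k. 2 * (sqrt (8 * \<eta> / \<alpha>) * (1 / 2) ^ k))"
    by (rule summable_mult[OF summable_mult[OF summable_geometric]]) simp
  have "summable (\<lambda>k. \<integral>x. \<bar>f (Suc k) x - f k x\<bar> \<partial>\<pi>)"
  proof (rule summable_comparison_test'[OF geometric])
    fix k :: nat
    have "norm (\<integral>x. \<bar>f (Suc k) x - f k x\<bar> \<partial>\<pi>) = (\<integral>x. \<bar>f (Suc k) x - f k x\<bar> \<partial>\<pi>)"
      by simp
    then show "norm (\<integral>x. \<bar>f (Suc k) x - f k x\<bar> \<partial>\<pi>) \<le> 2 * (sqrt (8 * \<eta> / \<alpha>) * (1 / 2) ^ k)"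
      by (rule ord_eq_le_trans[OF _ L1])
  qed
  from densities_summable_limit[OF f(1) this]
  obtain g where g: "g \<in> densities \<pi>" "AE x in \<pi>. (\<lambda>k. f k x) \<longlonglongrightarrow> g x" .
  \<comment> \<open>The objective raised by B / \<eta>, as a nonnegative functional of the density;
    this is the quantity that is lower semicontinuous along \<open>f\<close>.\<close>
  define I where "I h = (\<integral>\<^sup>+ x. ennreal (\<Sum>s = 1..<t. loss s x) * ennreal (h x) +
      ennreal (1 / \<eta>) * e2ennreal (\<phi> (h x) + ereal B) \<partial>\<pi>)" for h
  have obj: "ftrl_objective loss \<phi> \<pi> \<eta> t (density \<pi> (\<lambda>x. ennreal (h x))) =
      enn2ereal (I h) - ereal (B / \<eta>)" if "h \<in> densities \<pi>" for h
    unfolding I_def by (rule ftrl_objective_density[OF that eta loss_measurable loss_nonneg])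
  have I_le: "I (f k) \<le> ennreal (m + (1 / 4) ^ k + B / \<eta>)" for k
  proof -
    have "enn2ereal (I (f k)) - ereal (B / \<eta>) = ereal (objective t (r k))"
      using obj[OF f(1), of k] ftrl_objective_F[OF r(1), of t k] by (simp add: f(2))
    then have "I (f k) = ennreal (objective t (r k) + B / \<eta>)"
      by (cases "I (f k)") auto
    then show ?thesis
      using r(2)[of k] by (auto intro!: ennreal_leI)
  qed
  have "I g \<le> liminf (\<lambda>k. I (f k))"
    unfolding I_def by (rule penalised_integral_lsc[OF f(1) g]) measurable
  also have "\<dots> \<le> liminf (\<lambda>k. ennreal (m + (1 / 4) ^ k + B / \<eta>))"
    using I_le by (intro Liminf_mono) auto
  also have "\<dots> = ennreal (m + 0 + B / \<eta>)"
    by (intro lim_imp_Liminf tendsto_ennrealI tendsto_intros LIMSEQ_realpow_zero) auto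
  finally have "enn2ereal (I g) \<le> ereal (m + B / \<eta>)"
    using m_nonneg B eta by (simp add: less_eq_ennreal.rep_eq del: ennreal_plus)
  then have le: "ftrl_objective loss \<phi> \<pi> \<eta> t (density \<pi> (\<lambda>x. ennreal (g x))) \<le> ereal m"
    unfolding obj[OF g(1)] by (cases "I g") auto
  \<comment> \<open>An objective value of at most the real number \<open>m\<close> excludes infinite
    divergence, so the limit stays in \<open>F\<close>.\<close>
  then have F: "density \<pi> (\<lambda>x. ennreal (g x)) \<in> F"
    using ftrl_objective_not_F(1)[OF densitiesD(5)[OF g(1)]] by force
  with le show ?thesis
    using m_le by (intro bexI[OF _ F]) (auto simp: ftrl_objective_F intro: order_trans)
qed

text \<open>Outside \<open>F\<close> the objective is \<infinity>, while the prior gives a finite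
  value; minimising over all probability measures thus reduces to a real problem on
  \<open>F\<close>.\<close>

lemma is_arg_min_iff:
  "is_arg_min (ftrl_objective loss \<phi> \<pi> \<eta> t) (\<lambda>\<rho>. \<rho> \<in> prob_measures \<pi>) \<rho> \<longleftrightarrow>
    \<rho> \<in> F \<and> (\<forall>\<mu>\<in>F. objective t \<rho> \<le> objective t \<mu>)"
proof safe
  assume *: "is_arg_min (ftrl_objective loss \<phi> \<pi> \<eta> t) (\<lambda>\<rho>. \<rho> \<in> prob_measures \<pi>) \<rho>"
  then have le: "ftrl_objective loss \<phi> \<pi> \<eta> t \<rho> \<le> ereal (objective t \<mu>)" if "\<mu> \<in> F" for \<mu>
    using that ftrl_objective_F[OF that] F_prob[OF that] by (auto simp: is_arg_min_linorder)
  from le[OF prior_in_F] * show "\<rho> \<in> F"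
    using ftrl_objective_not_F(1)[of \<rho> t] by (force simp: is_arg_min_def)
  then show "objective t \<rho> \<le> objective t \<mu>" if "\<mu> \<in> F" for \<mu>
    using le[OF that] by (simp add: ftrl_objective_F)
next
  assume \<rho>: "\<rho> \<in> F" and min: "\<forall>\<mu>\<in>F. objective t \<rho> \<le> objective t \<mu>"
  have "ftrl_objective loss \<phi> \<pi> \<eta> t \<rho> \<le> ftrl_objective loss \<phi> \<pi> \<eta> t \<mu>" if "\<mu> \<in> prob_measures \<pi>" for \<mu>
    using min ftrl_objective_F ftrl_objective_not_F(1)[OF that] \<rho> by (cases "\<mu> \<in> F") auto
  then show "is_arg_min (ftrl_objective loss \<phi> \<pi> \<eta> t) (\<lambda>\<rho>. \<rho> \<in> prob_measures \<pi>) \<rho>"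
    using F_prob[OF \<rho>] by (simp add: is_arg_min_linorder)
qed

text \<open>For uniqueness, quadratic growth from one minimiser to another leaves no room for a
  positive gap.\<close>

lemma ex1_arg_min:
  "\<exists>!\<rho>. is_arg_min (ftrl_objective loss \<phi> \<pi> \<eta> t) (\<lambda>\<rho>. \<rho> \<in> prob_measures \<pi>) \<rho>"
  unfolding is_arg_min_iff
proof (rule ex_ex1I)
  show "\<exists>\<rho>. \<rho> \<in> F \<and> (\<forall>\<mu>\<in>F. objective t \<rho> \<le> objective t \<mu>)"
    using objective_minimizer by blast
next
  fix \<rho> \<rho>'
  assume \<rho>: "\<rho> \<in> F \<and> (\<forall>\<mu>\<in>F. objective t \<rho> \<le> objective t \<mu>)"
    and \<rho>': "\<rho>' \<in> F \<and> (\<forall>\<mu>\<in>F. objective t \<rho>' \<le> objective t \<mu>)"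
  then have "\<alpha> / (4 * \<eta>) * (gap \<rho> \<rho>')\<^sup>2 \<le> 0"
    using objective_growth[of \<rho> t \<rho>'] by force
  moreover have "0 < \<alpha> / (4 * \<eta>)"
    using alpha eta by simp
  ultimately have "gap \<rho> \<rho>' = 0"
    using mult_pos_pos[of "\<alpha> / (4 * \<eta>)" "(gap \<rho> \<rho>')\<^sup>2"] by (metis not_less zero_less_power2)
  then show "\<rho> = \<rho>'"
    using \<rho> \<rho>' gap_eq_0 by blast
qed

section \<open>Regret of the sequence of minimisers\<close>

abbreviation "leader t \<equiv> arg_min_on (ftrl_objective loss \<phi> \<pi> \<eta> t) (prob_measures \<pi>)"

lemma leader:
  shows "leader t \<in> F" "\<mu> \<in> F \<Longrightarrow> objective t (leader t) \<le> objective t \<mu>"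
proof -
  have "is_arg_min (ftrl_objective loss \<phi> \<pi> \<eta> t) (\<lambda>\<rho>. \<rho> \<in> prob_measures \<pi>) (leader t)"
    unfolding arg_min_on_def arg_min_def using ex1_arg_min by (rule ex1_implies_ex[THEN someI_ex])
  then show "leader t \<in> F" "\<mu> \<in> F \<Longrightarrow> objective t (leader t) \<le> objective t \<mu>"
    by (auto simp: is_arg_min_iff)
qed

lemma leader_step:
  assumes "1 \<le> t"
  shows "avg_loss t (leader t) \<le>
    objective (Suc t) (leader (Suc t)) - objective t (leader t) + \<eta> * L\<^sup>2 / \<alpha>"
proof -
  define n where "n = gap (leader t) (leader (Suc t))"
  \<comment> \<open>Completing the square: n = 2 \<eta> L / \<alpha> maximises L n - \<alpha> / (4
    \<eta>) n^2, and the maximum is the per-round cost \<eta> L^2 / \<alpha>.\<close>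
  have "0 \<le> \<alpha> / (4 * \<eta>) * (n - 2 * \<eta> * L / \<alpha>)\<^sup>2"
    using alpha eta by simp
  also have "\<dots> = \<alpha> / (4 * \<eta>) * n\<^sup>2 - L * n + \<eta> * L\<^sup>2 / \<alpha>"
    using alpha eta by (simp add: field_simps power2_eq_square)
  finally have "L * n \<le> \<alpha> / (4 * \<eta>) * n\<^sup>2 + \<eta> * L\<^sup>2 / \<alpha>"
    by simp
  moreover have "objective t (leader t) + \<alpha> / (4 * \<eta>) * n\<^sup>2 \<le> objective t (leader (Suc t))"
    unfolding n_def by (intro objective_growth leader)
  moreover have "avg_loss t (leader t) - avg_loss t (leader (Suc t)) \<le> L * n"
    unfolding n_def using avg_loss_lipschitz[OF leader(1) leader(1)] abs_le_D1 by blast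
  \<comment> \<open>\<open>objective t\<close> contains the losses of rounds 1 to t - 1, so passing
    to \<open>Suc t\<close> adds exactly round t, provided 1 \<le> t.\<close>
  moreover have "objective (Suc t) \<rho> = objective t \<rho> + avg_loss t \<rho>" for \<rho>
    using assms by (simp add: objective_def)
  ultimately show ?thesis
    by simp
qed

lemma leader_loss_le:
  assumes "\<rho> \<in> F"
  shows "(\<Sum>t = 1..T. avg_loss t (leader t)) \<le>
    (\<Sum>t = 1..T. avg_loss t \<rho>) + \<eta> * L\<^sup>2 * real T / \<alpha> + divergence \<rho> / \<eta>"
proof -
  have "(\<Sum>t = 1..T. avg_loss t (leader t)) \<le>
      objective (Suc T) (leader (Suc T)) - objective 1 (leader 1) + \<eta> * L\<^sup>2 * real T / \<alpha>"
  proof (induction T)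
    case (Suc T)
    then show ?case
      using leader_step[of "Suc T"] by (simp add: distrib_left distrib_right add_divide_distrib)
  qed simp
  moreover have "0 \<le> objective 1 (leader 1)"
    by (intro objective_nonneg leader)
  \<comment> \<open>The comparator enters only at the end: the leader after T rounds minimises the
    total loss of these rounds plus the penalty.\<close>
  moreover have "objective (Suc T) (leader (Suc T)) \<le> objective (Suc T) \<rho>"
    using assms by (rule leader)
  moreover have "objective (Suc T) \<rho> = (\<Sum>t = 1..T. avg_loss t \<rho>) + divergence \<rho> / \<eta>"
    by (simp add: objective_def atLeastLessThanSuc_atLeastAtMost)
  ultimately show ?thesis
    by simp
qed

text \<open>A comparator of infinite divergence makes the right-hand side \<infinity>; for the
  others the bound is \<open>leader_loss_le\<close>.\<close>

lemma leader_regret: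
  "(\<Sum>t = 1..T. exp_loss loss t (leader t)) \<le>
    (INF \<rho>\<in>prob_measures \<pi>. (\<Sum>t = 1..T. exp_loss loss t \<rho>) + ereal (\<eta> * L\<^sup>2 * real T / \<alpha>) +
      phi_divergence \<phi> \<rho> \<pi> / ereal \<eta>)"
proof (rule INF_greatest)
  fix \<rho> assume \<rho>: "\<rho> \<in> prob_measures \<pi>"
  show "(\<Sum>t = 1..T. exp_loss loss t (leader t)) \<le>
    (\<Sum>t = 1..T. exp_loss loss t \<rho>) + ereal (\<eta> * L\<^sup>2 * real T / \<alpha>) + phi_divergence \<phi> \<rho> \<pi> / ereal \<eta>"
  proof (cases "\<rho> \<in> F")
    case True
    then show ?thesis
      using leader_loss_le[OF True, of T] eta by (simp add: F_loss[OF leader(1)] F_loss F_div)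
  next
    case False
    have "0 \<le> (\<Sum>t = 1..T. exp_loss loss t \<rho>)"
      using exp_loss_nonneg[OF \<rho>] by (intro sum_nonneg)
    then show ?thesis
      using ftrl_objective_not_F(2)[OF \<rho> False] eta by auto
  qed
qed

end

section \<open>From the prior to the underlying measurable space\<close>

theorem theorem2p1:
  fixes M \<pi> :: "'a measure" and \<eta> \<alpha> L :: real
    and loss :: "nat \<Rightarrow> 'a \<Rightarrow> real" and \<phi> :: "real \<Rightarrow> ereal"
    and N :: "('a set \<Rightarrow> real) \<Rightarrow> ennreal"
  assumes prior: "\<pi> \<in> prob_measures M"
    and eta: "\<eta> > 0"
    and loss_measurable: "\<And>t. loss t \<in> borel_measurable M"
    and loss_nonneg: "\<And>t \<theta>. \<theta> \<in> space M \<Longrightarrow> loss t \<theta> \<ge> 0"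
    and phi_convex: "strictly_convex_nonneg \<phi>"
    and phi_one: "\<phi> 1 = 0"
    and phi_bdd: "(INF x\<in>{0..}. \<phi> x) > -\<infinity>"
    and phi_lsc: "lsc_nonneg \<phi>"
    and alpha: "\<alpha> > 0" and L: "L > 0"
    and norm: "measure_norm M N"
    and norm_tv: "\<And>\<nu>. \<nu> \<in> signed_measures M \<Longrightarrow> N \<nu> \<ge> tv_norm M \<nu>"
    and loss_lipschitz: "\<And>t \<rho> \<rho>'. \<rho> \<in> finite_div_measures \<phi> \<pi> \<Longrightarrow> \<rho>' \<in> finite_div_measures \<phi> \<pi> \<Longrightarrow>
        \<bar>exp_loss loss t \<rho> - exp_loss loss t \<rho>'\<bar> \<le> ereal L * enn2ereal (N (diff_measures \<rho> \<rho>'))"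
    and div_strongly_convex: "\<And>\<gamma> \<rho> \<rho>'. \<gamma> \<in> {0..1} \<Longrightarrow>
        \<rho> \<in> finite_div_measures \<phi> \<pi> \<Longrightarrow> \<rho>' \<in> finite_div_measures \<phi> \<pi> \<Longrightarrow>
        phi_divergence \<phi> (mixture \<gamma> \<rho> \<rho>') \<pi>
          \<le> ereal \<gamma> * phi_divergence \<phi> \<rho> \<pi> + ereal (1 - \<gamma>) * phi_divergence \<phi> \<rho>' \<pi>
            - ereal (\<alpha> / 2 * \<gamma> * (1 - \<gamma>)) * (enn2ereal (N (diff_measures \<rho> \<rho>')))\<^sup>2"
    and loss_integrable: "\<And>t. integrable \<pi> (loss t)"
  shows "(\<forall>t\<ge>1. \<exists>!\<rho>. is_arg_min (ftrl_objective loss \<phi> \<pi> \<eta> t) (\<lambda>\<rho>. \<rho> \<in> prob_measures M) \<rho>) \<and>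
    (\<forall>T\<ge>1.
      (\<Sum>t = 1..T. exp_loss loss t (arg_min_on (ftrl_objective loss \<phi> \<pi> \<eta> t) (prob_measures M)))
        \<le> (INF \<rho>\<in>prob_measures M.
             (\<Sum>t = 1..T. exp_loss loss t \<rho>) + ereal (\<eta> * L\<^sup>2 * real T / \<alpha>)
               + phi_divergence \<phi> \<rho> \<pi> / ereal \<eta>))"
proof -
  have s: "sets \<pi> = sets M" and "prob_space \<pi>"
    using prior by (auto simp: space_prob_algebra)
  then interpret prob_space \<pi> by simp
  \<comment> \<open>\<open>M\<close> enters only through its space and its sigma-algebra, which
    \<pi> shares, so every hypothesis can be restated over \<pi>.\<close>
  have P: "prob_measures M = prob_measures \<pi>"
    by (simp add: space_prob_algebra s)
  note sp = sets_eq_imp_space_eq[OF s]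
  \<comment> \<open>Any real number below the infimum of \<phi> yields a shift;
    \<open>max 0 (- b)\<close> makes it nonnegative.\<close>
  obtain b where b: "ereal b < (INF x\<in>{0..}. \<phi> x)"
    using phi_bdd by (metis ereal_dense2)
  have lower: "- ereal (max 0 (- b)) \<le> \<phi> x" if "0 \<le> x" for x
  proof -
    have "ereal b \<le> \<phi> x"
      using b that by (meson INF_lower atLeast_iff less_imp_le less_le_trans)
    then show ?thesis
      by (rule order_trans[rotated]) (simp add: max_def)
  qed
  interpret ftrl \<pi> \<phi> "max 0 (- b)" \<eta> \<alpha> L loss N
  proof
    show "loss t \<in> borel_measurable \<pi>" for t
      using loss_measurable measurable_cong_sets[OF s refl] by blast
    show "tv_norm \<pi> \<nu> \<le> N \<nu>" if "\<nu> \<in> signed_measures \<pi>" for \<nu>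
      using norm_tv[of \<nu>] that by (simp add: tv_norm_def signed_measures_def s)
  qed (use assms sp lower in auto)
  show ?thesis
    unfolding P using ex1_arg_min leader_regret by blast
qed

end
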